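(* Let $L,C\in\mathbb{Z}[s,a]$ be the polynomials given in the context. The solutions $(s,a)\in\mathbb{Q}^2$ of the system \[ L(s,a)=0,\qquad C(s,a)=0 \] are exactly $(s,a)=(1,2)$ and $(s,a)=(-1,2)$. In particular, for $s\in\mathbb{Q}_{>0}$ with $s\neq 1$ there is no $a\in\mathbb{Q}$ with $L(s,a)=C(s,a)=0$.
   Context: Define polynomials in $\mathbb{Z}[s,a]$: \[ \begin{aligned} u={}&-3a^{2}+(12-4s^{2}-2s)a+(-s^{4}+14s^{3}-4s^{2}-10s-1),\\ v={}&a^{4}+(2s^{2}+s-6)a^{3}+(s^{4}-14s^{3}+4s^{2}+10s+1)a^{2}\\ &+(s^{5}+10s^{4}+4s^{3}-14s^{2}+s)a+(-6s^{5}+s^{4}+2s^{3}),\\ m={}&-2a-2s^{2}-s+6,\\ n={}&a^{3}+(2s^{2}+s-6)a^{2}+(s^{4}-14s^{3}+4s^{2}+10s+1)a+(s^{5}+10s^{4}+4s^{3}-14s^{2}+s), \end{aligned} \] and $L=n-mu$, $C=mv+s^5$. *)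

theory Defs
  imports Complex_Main "HOL-Computational_Algebra.Polynomial"
begin

text \<open>
  The ring $\mathbb{Z}[s,a]$ is represented as $\mathbb{Z}[s][a]$: in \<^typ>\<open>int poly poly\<close> the
  outer indeterminate is $a$ and the inner one is $s$.
\<close>

definition var_s :: "int poly poly" where
  "var_s = [:[:0, 1:]:]"

definition var_a :: "int poly poly" where
  "var_a = [:0, 1:]"

definition eval_sa :: "int poly poly \<Rightarrow> 'a::comm_ring_1 \<Rightarrow> 'a \<Rightarrow> 'a" where
  "eval_sa P s a = poly (map_poly (\<lambda>q. poly (map_poly of_int q) s) P) a"

definition u_poly :: "int poly poly" where
  "u_poly = - 3 * var_a^2 + (12 - 4 * var_s^2 - 2 * var_s) * var_a
     + (- (var_s^4) + 14 * var_s^3 - 4 * var_s^2 - 10 * var_s - 1)"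

definition v_poly :: "int poly poly" where
  "v_poly = var_a^4 + (2 * var_s^2 + var_s - 6) * var_a^3
     + (var_s^4 - 14 * var_s^3 + 4 * var_s^2 + 10 * var_s + 1) * var_a^2
     + (var_s^5 + 10 * var_s^4 + 4 * var_s^3 - 14 * var_s^2 + var_s) * var_a
     + (- 6 * var_s^5 + var_s^4 + 2 * var_s^3)"

definition m_poly :: "int poly poly" where
  "m_poly = - 2 * var_a - 2 * var_s^2 - var_s + 6"

definition n_poly :: "int poly poly" where
  "n_poly = var_a^3 + (2 * var_s^2 + var_s - 6) * var_a^2
     + (var_s^4 - 14 * var_s^3 + 4 * var_s^2 + 10 * var_s + 1) * var_a
     + (var_s^5 + 10 * var_s^4 + 4 * var_s^3 - 14 * var_s^2 + var_s)"

definition L_poly :: "int poly poly" where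
  "L_poly = n_poly - m_poly * u_poly"

definition C_poly :: "int poly poly" where
  "C_poly = m_poly * v_poly + var_s^5"


lemma poly_map_poly_add:
  fixes f :: "'a::comm_ring_1 \<Rightarrow> 'b::comm_ring_1"
  assumes "f 0 = 0" "\<And>x y. f (x + y) = f x + f y"
  shows "poly (map_poly f (p + q)) x = poly (map_poly f p) x + poly (map_poly f q) x"
proof -
  have "map_poly f (p + q) = map_poly f p + map_poly f q"
    by (rule poly_eqI) (simp add: coeff_map_poly assms)
  then show ?thesis by simp
qed

lemma poly_map_poly_mult:
  fixes f :: "'a::comm_ring_1 \<Rightarrow> 'b::comm_ring_1"
  assumes f: "f 0 = 0" "\<And>x y. f (x + y) = f x + f y" "\<And>x y. f (x * y) = f x * f y"
  shows "poly (map_poly f (p * q)) x = poly (map_poly f p) x * poly (map_poly f q) x"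
proof (induction p)
  case 0
  then show ?case by simp
next
  case (pCons c p)
  have "map_poly f (smult c q) = smult (f c) (map_poly f q)"
    by (rule poly_eqI) (simp add: coeff_map_poly f)
  with pCons show ?case
    by (simp add: poly_map_poly_add[of f] f map_poly_pCons algebra_simps)
qed

lemma eval_sa_add [simp]: "eval_sa (P + Q) s a = eval_sa P s a + eval_sa Q s a"
  unfolding eval_sa_def by (intro poly_map_poly_add) (simp_all add: poly_map_poly_add)

lemma eval_sa_mult [simp]: "eval_sa (P * Q) s a = eval_sa P s a * eval_sa Q s a"
  unfolding eval_sa_def
  by (intro poly_map_poly_mult) (simp_all add: poly_map_poly_add poly_map_poly_mult)

lemma eval_sa_0 [simp]: "eval_sa 0 s a = 0"
  by (simp add: eval_sa_def)

lemma eval_sa_1 [simp]: "eval_sa 1 s a = 1"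
  by (simp add: eval_sa_def)

lemma eval_sa_uminus [simp]: "eval_sa (- P) s a = - eval_sa P s a"
  using eval_sa_add[of P "- P" s a] by (simp add: eq_neg_iff_add_eq_0 add.commute)

lemma eval_sa_diff [simp]: "eval_sa (P - Q) s a = eval_sa P s a - eval_sa Q s a"
  using eval_sa_add[of P "- Q" s a] by simp

lemma eval_sa_power [simp]: "eval_sa (P ^ k) s a = eval_sa P s a ^ k"
  by (induction k) simp_all

lemma eval_sa_of_nat [simp]: "eval_sa (of_nat k) s a = of_nat k"
  by (induction k) simp_all

lemma eval_sa_numeral [simp]: "eval_sa (numeral k) s a = numeral k"
  using eval_sa_of_nat[of "numeral k"] by simp

lemma eval_sa_var_s [simp]: "eval_sa var_s s a = s"
  by (simp add: eval_sa_def var_s_def map_poly_pCons)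

lemma eval_sa_var_a [simp]: "eval_sa var_a s a = a"
  by (simp add: eval_sa_def var_a_def map_poly_pCons)

end

theory Submission
  imports Defs "HOL-Number_Theory.Cong"
begin

text \<open>
  As a polynomial in $a$, $L$ is a cubic with leading coefficient $-5$, so $C$ can be replaced by a
  multiple $G$ of its remainder modulo $L$, a quadratic in $a$.  The resultant of $L$ and $G$ with
  respect to $a$ is, up to a nonzero constant, $(s^2-1)^3 Q(s)$ with $Q$ of degree 21.  Modulo 13 the
  polynomial $Q$ has no root and does not drop in degree, so $Q$ has no rational root.  This
  leaves $s = \pm 1$, where $L$ has the single rational root $a = 2$.
\<close>

text \<open>A root \<open>a/b\<close> in lowest terms, after clearing denominators, gives an integer
  relation that can be read modulo \<open>p\<close>. If \<open>p\<close> divides \<open>b\<close>,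
  only the leading term survives, which forces \<open>p\<close> to divide \<open>a\<close> as well;
  otherwise \<open>b\<close> is invertible and \<open>a/b\<close> reduces to a root modulo
  \<open>p\<close>.\<close>

lemma no_rat_root_mod_prime:
  fixes q :: "int poly" and p :: int and s :: rat
  assumes "prime p" and lead: "\<not> p dvd lead_coeff q"
    and no_root: "\<And>x. x \<in> {0..<p} \<Longrightarrow> \<not> p dvd poly q x"
  shows "poly (map_poly of_int q) s \<noteq> 0"
proof
  assume root: "poly (map_poly of_int q) s = 0"
  obtain a b :: int where s: "s = Fract a b" and b: "b > 0" and ab: "coprime a b"
    by (cases s)
  let ?n = "degree q"
  have deg: "degree (map_poly of_int q :: rat poly) = ?n"
    by (rule degree_map_poly) simp
  define h where "h = (\<Sum>i\<le>?n. coeff q i * a ^ i * b ^ (?n - i))"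
  have "of_int h = (of_int b :: rat) ^ ?n * poly (map_poly of_int q) s"
    unfolding h_def poly_altdef of_int_sum sum_distrib_left deg
  proof (rule sum.cong)
    fix i assume "i \<in> {..?n}"
    then have "(of_int b :: rat) ^ ?n = of_int b ^ i * of_int b ^ (?n - i)"
      by (simp flip: power_add)
    then show "of_int (coeff q i * a ^ i * b ^ (?n - i))
        = (of_int b :: rat) ^ ?n * (coeff (map_poly of_int q) i * s ^ i)"
      using b by (simp add: s Fract_of_int_quotient power_divide coeff_map_poly)
  qed simp
  then have h0: "h = 0" using root by simp
  show False
  proof (cases "p dvd b")
    case True
    have "h = (\<Sum>i<?n. coeff q i * a ^ i * b ^ (?n - i)) + lead_coeff q * a ^ ?n"
      by (simp add: h_def flip: lessThan_Suc_atMost)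
    \<comment> \<open>For \<open>i < ?n\<close> the exponent of \<open>b\<close> is
      positive.\<close>
    moreover have "p dvd (\<Sum>i<?n. coeff q i * a ^ i * b ^ (?n - i))"
      using True by (intro dvd_sum dvd_mult) (simp add: dvd_power_iff_le dvd_trans[OF _ dvd_power])
    ultimately have "p dvd lead_coeff q * a ^ ?n"
      using h0 by (metis dvd_0_right dvd_add_right_iff)
    then have "p dvd a"
      using lead \<open>prime p\<close> by (metis prime_dvd_mult_iff prime_dvd_power)
    with True ab \<open>prime p\<close> show False
      by (meson coprime_common_divisor not_prime_unit)
  next
    case False
    then have "coprime b p"
      using prime_imp_coprime[of p b] \<open>prime p\<close> by (simp add: coprime_commute)
    then obtain c where c: "[b * c = 1] (mod p)"
      using cong_solve_coprime_int by blast
    \<comment> \<open>Since \<open>c\<close> inverts \<open>b\<close>, this \<open>x\<close> is the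
      residue of \<open>a/b\<close>.\<close>
    define x where "x = a * c mod p"
    have "[b * x = a * (b * c)] (mod p)"
      by (simp add: x_def cong_def mod_mult_right_eq ac_simps)
    also have "[a * (b * c) = a * 1] (mod p)"
      by (intro cong_mult cong_refl c)
    finally have a: "[a = b * x] (mod p)" by (simp add: cong_sym)
    have "[h = (\<Sum>i\<le>?n. coeff q i * (b * x) ^ i * b ^ (?n - i))] (mod p)"
      unfolding h_def by (intro cong_sum cong_mult cong_pow cong_refl a)
    also have "(\<Sum>i\<le>?n. coeff q i * (b * x) ^ i * b ^ (?n - i)) = b ^ ?n * poly q x"
      unfolding poly_altdef sum_distrib_left
    proof (rule sum.cong)
      fix i assume "i \<in> {..?n}"
      then have "b ^ ?n = b ^ i * b ^ (?n - i)" by (simp flip: power_add)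
      then show "coeff q i * (b * x) ^ i * b ^ (?n - i) = b ^ ?n * (coeff q i * x ^ i)"
        by (simp add: power_mult_distrib)
    qed simp
    finally have "p dvd b ^ ?n * poly q x"
      using h0 by (simp add: cong_0_iff cong_sym_eq[of 0])
    then have "p dvd poly q x"
      using False \<open>prime p\<close> by (metis prime_dvd_mult_iff prime_dvd_power)
    moreover have "x \<in> {0..<p}"
      using \<open>prime p\<close> by (simp add: x_def prime_gt_0_int)
    ultimately show False using no_root by blast
  qed
qed

text \<open>
  The $3 \times 3$ determinant is the Bezout resultant: its rows are the coefficients of three
  quadratics vanishing at $x$, namely $g$, $g_2 f - f_3 x g$ and
  $(g_2 x + g_1) f - (f_3 x + f_2) x g$.
\<close>

lemma resultant_cubic_quadratic:
  fixes x :: "'a::idom"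
  assumes f: "f3 * x^3 + f2 * x^2 + f1 * x + f0 = 0"
    and g: "g2 * x^2 + g1 * x + g0 = 0"
    and "h11 = g2 * f2 - f3 * g1" "h12 = g2 * f1 - f3 * g0" "h13 = g2 * f0"
      "h23 = g2 * f0 + g1 * f1 - f2 * g0" "h33 = g1 * f0"
  shows "g2 * (h12 * h33 - h13 * h23) - g1 * (h11 * h33 - h13 * h12)
     + g0 * (h11 * h23 - h12 * h12) = 0"
proof -
  have r1: "h11 * x^2 + h12 * x + h13 = 0" using f g assms(3-) by algebra
  have r2: "h12 * x^2 + h23 * x + h33 = 0" using f g assms(3-) by algebra
  show ?thesis using g r1 r2 by algebra
qed

text \<open>The cofactor of \<open>- 125000 * (s^2 - 1)^3\<close> in the resultant, constant term
  first.\<close>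

definition Q_poly :: "int poly" where
  "Q_poly = [:110592, 5345280, - 7745280, - 231674112, 1276740780, - 2603612444, 1048464803,
     5021608234, - 9219354518, 3706299882, 6526416706, - 8848608460, 2266872188, 3001419440,
     - 2381234573, 96206522, 516056006, - 164061982, - 25552432, 17845256, - 1573888, 32768:]"

lemma Q_no_rat_root: "poly (map_poly of_int Q_poly) (s :: rat) \<noteq> 0"
proof (rule no_rat_root_mod_prime[of 13])
  show "prime (13 :: int)" by simp
  \<comment> \<open>The leading coefficient is \<open>2^15\<close>.\<close>
  show "\<not> 13 dvd lead_coeff Q_poly" by (simp add: Q_poly_def)
  fix x :: int assume "x \<in> {0..<13}"
  then have "x \<in> set [0..12]" by simp
  then show "\<not> 13 dvd poly Q_poly x"
    by (simp add: Q_poly_def upto_rec1) (elim disjE; simp)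
qed

lemma eval_L:
  "eval_sa L_poly s a = - 5 * a^3 + (- 12 * s^2 - 6 * s + 36) * a^2
     + (- 9 * s^4 + 6 * s^3 + 42 * s^2 + 14 * s - 73) * a
     + (- 2 * s^6 + 28 * s^5 + 22 * s^4 - 104 * s^3 - 2 * s^2 + 60 * s + 6)"
  by (simp add: L_poly_def n_poly_def m_poly_def u_poly_def algebra_simps power_numeral_reduce)

lemma quadratic_remainder:
  fixes s a :: rat
  assumes "eval_sa L_poly s a = 0" "eval_sa C_poly s a = 0"
  shows "(12 * s^6 + 2868 * s^5 + 996 * s^4 - 10824 * s^3 + 3732 * s^2 + 8052 * s - 4644) * a^2
    + (24 * s^8 + 3248 * s^7 - 2211 * s^6 - 16716 * s^5 + 2462 * s^4 + 39508 * s^3 - 15907 * s^2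
       - 26320 * s + 15352) * a
    + (12 * s^10 + 444 * s^9 - 9159 * s^8 - 988 * s^7 + 44847 * s^6 - 20992 * s^5 - 52725 * s^4
       + 32884 * s^3 + 18485 * s^2 - 11172 * s - 1284) = 0" (is "?G = 0")
proof -
  \<comment> \<open>Pseudo-division in \<open>a\<close>: three steps take the degree from 5 to 2,
    each costing a factor -5, hence -125. The bracket is the pseudo-quotient; the pseudo-remainder
    has a common factor 2.\<close>
  have "2 * ?G = - 125 * eval_sa C_poly s a
    - (- 50 * a^2 + (90 - 15 * s - 30 * s^2) * a + (428 - 556 * s - 459 * s^2 + 612 * s^3 + 12 * s^4))
      * eval_sa L_poly s a"
    unfolding eval_L by (simp add: C_poly_def m_poly_def v_poly_def) algebra
  then show ?thesis using assms by simp
qed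

lemma resultant_vanishes:
  fixes s a :: rat
  assumes "eval_sa L_poly s a = 0" "eval_sa C_poly s a = 0"
  shows "- 125000 * (s^2 - 1)^3 * poly (map_poly of_int Q_poly) s = 0"
proof -
  note r = resultant_cubic_quadratic[OF assms(1)[unfolded eval_L] quadratic_remainder[OF assms]
     refl refl refl refl refl]
  show ?thesis
    \<comment> \<open>The determinant involves \<open>s\<close> only, and its factorization is a
      polynomial identity.\<close>
    by (rule trans[OF _ r]) (simp add: Q_poly_def map_poly_pCons, algebra)
qed

lemma L_root_at_pm1:
  fixes a :: rat
  assumes "s = 1 \<or> s = - 1" "eval_sa L_poly s a = 0"
  shows "a = 2"
  using assms(1)
proof
  assume "s = 1"
  \<comment> \<open>At \<open>s = 1\<close> the left side is -5 times L; the quadratic factor has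
    its square completed.\<close>
  then have "(a - 2) * ((5 * a - 4)^2 + 4) = 0"
    using assms(2) by (simp add: eval_L) algebra
  moreover have "(5 * a - 4)^2 + 4 > 0" by (simp add: add_nonneg_pos)
  ultimately show ?thesis by simp
next
  assume "s = - 1"
  \<comment> \<open>At \<open>s = - 1\<close>, L equals \<open>- 5 * (a - 2)^3\<close>.\<close>
  then have "(a - 2)^3 = 0" using assms(2) by (simp add: eval_L) algebra
  then show ?thesis by simp
qed

theorem proposition3:
  shows "{(s :: rat, a :: rat). eval_sa L_poly s a = 0 \<and> eval_sa C_poly s a = 0} = {(1, 2), (- 1, 2)}
    \<and> (\<forall>s :: rat. s > 0 \<longrightarrow> s \<noteq> 1 \<longrightarrow>
          \<not> (\<exists>a :: rat. eval_sa L_poly s a = 0 \<and> eval_sa C_poly s a = 0))"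
proof -
  have only: "(s = 1 \<or> s = - 1) \<and> a = 2"
    if "eval_sa L_poly s a = 0" "eval_sa C_poly s a = 0" for s a :: rat
  proof -
    have "s^2 = 1" using resultant_vanishes[OF that] Q_no_rat_root[of s] by simp
    then have "s = 1 \<or> s = - 1" by (simp add: power2_eq_1_iff)
    then show ?thesis using L_root_at_pm1 that(1) by blast
  qed
  have "eval_sa L_poly s 2 = 0 \<and> eval_sa C_poly s 2 = 0" if "s = 1 \<or> s = - 1" for s :: rat
    using that by (auto simp: eval_L C_poly_def m_poly_def v_poly_def)
  with only have "eval_sa L_poly s a = 0 \<and> eval_sa C_poly s a = 0 \<longleftrightarrow> (s, a) \<in> {(1, 2), (- 1, 2)}"
    for s a :: rat by auto
  then show ?thesis by auto
qed

end
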